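(* Let $n\ge 1$ be an integer and let $f:\{0,1\}^n\to\{0,1\}$ be an arbitrary boolean function. Then $f$ can be exactly represented by a Matrix Product State (MPS): there exists an MPS function $\Psi$ with $n$ inputs such that $\Psi(X_1,\dots,X_n)=f(X_1,\dots,X_n)$ for all $(X_1,\dots,X_n)\in\{0,1\}^n$.
   Context: An MPS function with $n$ inputs is a real-valued function of the form $$\Psi(x_1,\dots,x_n)=\sum_{\{\alpha,s\}}A^{s_1}_{(1)\,\alpha_1\alpha_2}A^{s_2}_{(2)\,\alpha_2\alpha_3}\cdots A^{s_n}_{(n)\,\alpha_n\alpha_1}\,\Phi^{s_1\cdots s_n}(x_1,\dots,x_n),\qquad \Phi^{s_1\cdots s_n}(x_1,\dots,x_n)=\prod_{i=1}^n\phi_i^{s_i}(x_i).$$ Here, for each $i\in\{1,\dots,n\}$: the kernel dimension $d_i\ge1$ is an integer and $s_i$ ranges over $\{1,\dots,d_i\}$; the bond dimension $D_i\ge 1$ is an integer and $\alpha_i$ ranges over $\{1,\dots,D_i\}$ (with $\alpha_{n+1}=\alpha_1$, $D_{n+1}=D_1$); each $A_{(i)}$ is a real tensor of size $d_i\times D_i\times D_{i+1}$; and $\phi_i=(\phi_i^1,\dots,\phi_i^{d_i})$ is a map from the $i$-th input variable to $\mathbb{R}^{d_i}$ (so $\Phi$, called the kernel function, is the tensor product of the $\phi_i$). The sum is over all $\alpha_i$ and $s_i$. Bond dimensions may differ from site to site; the open boundary case is $D_1=1$. Values $0,1\in\{0,1\}$ are regarded as real numbers. *)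

theory Defs
  imports Complex_Main "HOL-Library.FuncSet"
begin

text \<open>
  Sites are numbered \<open>1, ..., n\<close>, and families indexed by sites are functions on \<open>nat\<close>.
  Only the entries \<open>A i s a b\<close> with \<open>i \<in> {1..n}\<close>, \<open>s \<in> {1..d i}\<close>, \<open>a \<in> {1..D i}\<close>
  and \<open>b \<in> {1..D (next_site n i)}\<close>, and the components \<open>phi i x s\<close> with \<open>s \<in> {1..d i}\<close>,
  enter the definitions below; so \<open>A i\<close> encodes a tensor of size
  \<open>d i \<times> D i \<times> D (next_site n i)\<close> and \<open>phi i\<close> a map into \<open>d i\<close>-dimensional real space.
\<close>

definition next_site :: "nat \<Rightarrow> nat \<Rightarrow> nat" where
  "next_site n i = (if i = n then 1 else i + 1)"

definition kernel_function ::
    "nat \<Rightarrow> (nat \<Rightarrow> 'x \<Rightarrow> nat \<Rightarrow> real) \<Rightarrow> (nat \<Rightarrow> nat) \<Rightarrow> (nat \<Rightarrow> 'x) \<Rightarrow> real" where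
  "kernel_function n phi s x = (\<Prod>i\<in>{1..n}. phi i (x i) (s i))"

definition mps ::
    "nat \<Rightarrow> (nat \<Rightarrow> nat) \<Rightarrow> (nat \<Rightarrow> nat) \<Rightarrow> (nat \<Rightarrow> nat \<Rightarrow> nat \<Rightarrow> nat \<Rightarrow> real) \<Rightarrow>
      (nat \<Rightarrow> 'x \<Rightarrow> nat \<Rightarrow> real) \<Rightarrow> (nat \<Rightarrow> 'x) \<Rightarrow> real" where
  "mps n d D A phi x =
    (\<Sum>\<alpha>\<in>(\<Pi>\<^sub>E i\<in>{1..n}. {1..D i}). \<Sum>s\<in>(\<Pi>\<^sub>E i\<in>{1..n}. {1..d i}).
      (\<Prod>i\<in>{1..n}. A i (s i) (\<alpha> i) (\<alpha> (next_site n i))) * kernel_function n phi s x)"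

definition is_mps_function :: "nat \<Rightarrow> ((nat \<Rightarrow> 'x) \<Rightarrow> real) \<Rightarrow> bool" where
  "is_mps_function n \<Psi> \<longleftrightarrow>
    (\<exists>d D A phi. (\<forall>i\<in>{1..n}. d i \<ge> 1 \<and> D i \<ge> 1) \<and> (\<forall>x. \<Psi> x = mps n d D A phi x))"

end

theory Submission imports Defs begin

text \<open>
  Taking for every site the diagonal tensor with a single value for the kernel index and both bond
  indices shows that any finite sum of products of one-variable functions is an MPS function.
  A boolean function is such a sum, over all \<open>c \<in> {0,1}\<^sup>n\<close>, of \<open>f c\<close> times the indicator of \<open>c\<close>.
\<close>

text \<open>Induction upward from site 1: below \<open>n\<close> the next site is
  \<open>i + 1\<close>, so each equality carries the value at site 1 one site further.\<close>

lemma eq_next_site_imp_const: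
  assumes "\<And>i. i \<in> {1..n} \<Longrightarrow> \<alpha> i = \<alpha> (next_site n i)" and "i \<in> {1..n}"
  shows "\<alpha> i = \<alpha> 1"
proof -
  have "1 \<le> i \<Longrightarrow> i \<le> n \<Longrightarrow> \<alpha> i = \<alpha> 1"
  proof (induction i rule: dec_induct)
    case (step m)
    then show ?case
      using assms(1)[of m] by (simp add: next_site_def)
  qed simp
  then show ?thesis
    using assms(2) by simp
qed

lemma prod_indicator:
  fixes P :: "'a \<Rightarrow> bool"
  assumes "finite I"
  shows "(\<Prod>i\<in>I. if P i then 1 else 0 :: real) = (if \<forall>i\<in>I. P i then 1 else 0)"
  using assms by (induction I) auto

text \<open>In matrix terms, contracting the kernel index at site \<open>i\<close> leaves the
  diagonal matrix with entries \<open>g i (x i) k\<close>. The trace of the product of these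
  matrices over all sites is the required sum.\<close>

lemma is_mps_function_sum_prod:
  fixes g :: "nat \<Rightarrow> 'x \<Rightarrow> nat \<Rightarrow> real"
  assumes "n \<ge> 1" and "N \<ge> 1"
  shows "is_mps_function n (\<lambda>x. \<Sum>k\<in>{1..N}. \<Prod>i\<in>{1..n}. g i (x i) k)"
proof -
  define A :: "nat \<Rightarrow> nat \<Rightarrow> nat \<Rightarrow> nat \<Rightarrow> real"
    where "A = (\<lambda>i s a b. if s = a \<and> a = b then 1 else 0)"
  \<comment> \<open>All kernel and bond dimensions will be \<open>N\<close>, so \<open>T\<close>
    indexes both the sum over \<alpha> and the sum over \<open>s\<close>.\<close>
  define T where "T = (\<Pi>\<^sub>E i\<in>{1..n}. {1..N})"
  \<comment> \<open>Restricting to \<open>{1..n}\<close> gives the value \<open>undefined\<close>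
    elsewhere, so that \<open>const k\<close> is extensional and can be an element of
    \<open>T\<close>.\<close>
  define const where "const = (\<lambda>k. \<lambda>i\<in>{1..n}. k :: nat)"
  have fin: "finite T"
    unfolding T_def by (intro finite_PiE) auto
  have one: "1 \<in> {1..n}"
    using assms(1) by simp
  have const_iff: "(\<forall>i\<in>{1..n}. \<alpha> i = \<alpha> (next_site n i)) \<longleftrightarrow> \<alpha> \<in> const ` {1..N}"
    if \<alpha>: "\<alpha> \<in> T" for \<alpha>
  proof
    assume "\<forall>i\<in>{1..n}. \<alpha> i = \<alpha> (next_site n i)"
    then have *: "\<alpha> i = \<alpha> 1" if "i \<in> {1..n}" for i
      using eq_next_site_imp_const that by blast
    have "\<alpha> = const (\<alpha> 1)"
    proof (rule extensionalityI)
      show "\<alpha> \<in> extensional {1..n}"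
        using \<alpha> by (simp add: T_def PiE_def)
      show "const (\<alpha> 1) \<in> extensional {1..n}"
        by (simp add: const_def)
      show "\<alpha> i = const (\<alpha> 1) i" if "i \<in> {1..n}" for i
        using *[OF that] that by (simp add: const_def)
    qed
    moreover have "\<alpha> 1 \<in> {1..N}"
      using \<alpha> one unfolding T_def by blast
    ultimately show "\<alpha> \<in> const ` {1..N}"
      by blast
  next
    assume "\<alpha> \<in> const ` {1..N}"
    then show "\<forall>i\<in>{1..n}. \<alpha> i = \<alpha> (next_site n i)"
      using assms(1) by (auto simp: const_def next_site_def)
  qed
  \<comment> \<open>A product of indicators is the indicator of the conjunction. Here the
    conjunction says that \<open>s\<close> agrees with \<alpha> at every site and that \<alpha> is
    constant around the ring.\<close>
  have prod_A: "(\<Prod>i\<in>{1..n}. A i (s i) (\<alpha> i) (\<alpha> (next_site n i)))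
      = (if s = \<alpha> then if \<alpha> \<in> const ` {1..N} then 1 else 0 else 0)"
    if \<alpha>: "\<alpha> \<in> T" and s: "s \<in> T" for \<alpha> s
  proof -
    have "s = \<alpha> \<longleftrightarrow> (\<forall>i\<in>{1..n}. s i = \<alpha> i)"
      using PiE_ext[OF s[unfolded T_def] \<alpha>[unfolded T_def]] by blast
    then show ?thesis
      unfolding A_def const_iff[OF \<alpha>, symmetric] by (auto simp: prod_indicator)
  qed
  have inj: "inj_on const {1..N}"
  proof (rule inj_onI)
    fix k l assume "const k = const l"
    from fun_cong[OF this, of 1] show "k = l"
      using one by (simp add: const_def)
  qed
  have sub: "const ` {1..N} \<subseteq> T"
    by (auto simp: const_def T_def)
  have "mps n (\<lambda>_. N) (\<lambda>_. N) A g x = (\<Sum>k\<in>{1..N}. \<Prod>i\<in>{1..n}. g i (x i) k)" for x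
  proof -
    have "mps n (\<lambda>_. N) (\<lambda>_. N) A g x
        = (\<Sum>\<alpha>\<in>T. \<Sum>s\<in>T. if s = \<alpha> then if \<alpha> \<in> const ` {1..N}
            then kernel_function n g s x else 0 else 0)"
      unfolding mps_def T_def[symmetric] by (intro sum.cong refl) (simp add: prod_A del: One_nat_def)
    also have "\<dots> = (\<Sum>\<alpha>\<in>T. if \<alpha> \<in> const ` {1..N} then kernel_function n g \<alpha> x else 0)"
      using fin by (intro sum.cong refl) simp
    also have "\<dots> = (\<Sum>\<alpha>\<in>const ` {1..N}. kernel_function n g \<alpha> x)"
      using fin sub by (simp add: sum.If_cases Int_absorb1)
    also have "\<dots> = (\<Sum>k\<in>{1..N}. kernel_function n g (const k) x)"
      using inj by (simp add: sum.reindex)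
    also have "\<dots> = (\<Sum>k\<in>{1..N}. \<Prod>i\<in>{1..n}. g i (x i) k)"
      by (simp add: kernel_function_def const_def)
    finally show ?thesis .
  qed
  then show ?thesis
    unfolding is_mps_function_def using assms(2)
    by (intro exI[of _ "\<lambda>_. N"] exI[of _ A] exI[of _ g]) simp
qed

theorem theorem2p5:
  fixes n :: nat and f :: "(nat \<Rightarrow> real) \<Rightarrow> real"
  assumes "n \<ge> 1"
    and "f \<in> ({1..n} \<rightarrow>\<^sub>E {0, 1}) \<rightarrow> {0, 1}"
  shows "\<exists>\<Psi> :: (nat \<Rightarrow> real) \<Rightarrow> real. is_mps_function n \<Psi> \<and>
    (\<forall>X \<in> {1..n} \<rightarrow>\<^sub>E {0, 1}. \<Psi> X = f X)"
proof -
  define C :: "(nat \<Rightarrow> real) set" where "C = ({1..n} \<rightarrow>\<^sub>E {0, 1})"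
  have fin: "finite C"
    unfolding C_def by (intro finite_PiE) auto
  \<comment> \<open>The bond dimension will be \<open>card C\<close>, that is, 2 to the power
    \<open>n\<close>, and it must be at least 1.\<close>
  have "C \<noteq> {}"
    by (simp add: C_def PiE_eq_empty_iff)
  then have N: "card C \<ge> 1"
    using fin by (simp add: Suc_le_eq card_gt_0_iff)
  obtain e where e: "bij_betw e {1..card C} C"
    using ex_bij_betw_nat_finite_1[OF fin] by blast
  \<comment> \<open>The coefficient \<open>f (e k)\<close> is placed at site 1 only, so that it
    enters the product over the sites exactly once. The other factors multiply to the indicator of
    the point \<open>e k\<close>.\<close>
  define g :: "nat \<Rightarrow> real \<Rightarrow> nat \<Rightarrow> real" where
    "g = (\<lambda>i y k. (if i = 1 then f (e k) else 1) * (if y = e k i then 1 else 0))"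
  have "(\<Sum>k\<in>{1..card C}. \<Prod>i\<in>{1..n}. g i (X i) k) = f X" if X: "X \<in> C" for X
  proof -
    have "(\<Sum>k\<in>{1..card C}. \<Prod>i\<in>{1..n}. g i (X i) k)
        = (\<Sum>k\<in>{1..card C}. f (e k) * (if \<forall>i\<in>{1..n}. X i = e k i then 1 else 0))"
      using assms(1) by (simp add: g_def prod.distrib prod_indicator)
    also have "\<dots> = (\<Sum>c\<in>C. f c * (if \<forall>i\<in>{1..n}. X i = c i then 1 else 0))"
      by (rule sum.reindex_bij_betw[OF e])
    also have "\<dots> = (\<Sum>c\<in>C. if c = X then f c else 0)"
    proof (intro sum.cong refl)
      fix c assume "c \<in> C"
      \<comment> \<open>Both points are extensional, so agreement on \<open>{1..n}\<close> is
        equality.\<close>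
      then have "(\<forall>i\<in>{1..n}. X i = c i) \<longleftrightarrow> c = X"
        using X PiE_ext[of c "{1..n}" "\<lambda>_. {0, 1}" X] unfolding C_def by auto
      then show "f c * (if \<forall>i\<in>{1..n}. X i = c i then 1 else 0) = (if c = X then f c else 0)"
        by simp
    qed
    also have "\<dots> = f X"
      using fin X by simp
    finally show ?thesis .
  qed
  then show ?thesis
    using is_mps_function_sum_prod[OF assms(1) N, of g] unfolding C_def by blast
qed

end
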